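(* Let $h=(h(n))_{n\ge1}$ be a sequence of positive real numbers with $h(1)=1$, and let $n\ge2$. The matrix $M_n^h$ is primitive. Consequently, its spectral radius $\rho_n^h>0$ is an algebraically simple eigenvalue of $M_n^h$, and every other eigenvalue $\beta$ of $M_n^h$ satisfies $|\beta|<\rho_n^h$. Moreover, there exist vectors $x,y\in\mathbb R^{n-1}$ with all components positive, normalized by \[ \sum_{k=1}^{n-1}x_k=1,\qquad y^Tx=1, \] such that \[ M_n^hx=\rho_n^hx,\qquad y^TM_n^h=\rho_n^hy^T, \] and \[ \lim_{m\to\infty}\left(\frac{M_n^h}{\rho_n^h}\right)^m=xy^T. \]
   Context: Let $\sigma(k)=\sum_{d\mid k}d$. The sequence $(c_n)_{n\ge0}$ is defined by $c_0:=1$ and $c_n:=\sum_{k=0}^{n-1}(-1)^{n-k+1}\sigma(n-k+1)\,c_k$ for $n\ge1$. For $n\ge2$, $M_n^h$ is the $(n-1)\times(n-1)$ matrix with entries, for $1\le i,j\le n-1$, \[ (M_n^h)_{ij}=\begin{cases} c_{i-j+1}\,h(j), & i\ge j-1,\\ 0, & j>i+1.\end{cases} \] A real square matrix $A$ with nonnegative entries is called primitive if there is an integer $k\ge1$ such that all entries of $A^k$ are strictly positive. *)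

theory Defs
  imports "HOL-Analysis.Analysis" "Jordan_Normal_Form.Spectral_Radius"
begin

definition sigma :: "nat \<Rightarrow> int" where
  "sigma k = (\<Sum>d | d dvd k. int d)"

fun c_seq :: "nat \<Rightarrow> int" where
  "c_seq n = (if n = 0 then 1
     else (\<Sum>k<n. (-1) ^ (n - k + 1) * sigma (n - k + 1) * c_seq k))"

declare c_seq.simps [simp del]

(* Matrix indices start at 0: the position (i, j) below is the entry with row index i + 1 and
   column index j + 1 in the mathematical notation. The value h 0 is never used. *)
definition M_mat :: "(nat \<Rightarrow> real) \<Rightarrow> nat \<Rightarrow> real mat" where
  "M_mat h n = mat (n - 1) (n - 1)
     (\<lambda>(i, j). if j \<le> i + 1 then of_int (c_seq (i + 1 - j)) * h (j + 1) else 0)"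

definition primitive_mat :: "real mat \<Rightarrow> bool" where
  "primitive_mat A \<longleftrightarrow> square_mat A \<and>
     (\<forall>i<dim_row A. \<forall>j<dim_col A. A $$ (i, j) \<ge> 0) \<and>
     (\<exists>k\<ge>1. \<forall>i<dim_row A. \<forall>j<dim_col A. (A ^\<^sub>m k) $$ (i, j) > 0)"

(* The spectrum of a real matrix is taken over the complex numbers. *)
abbreviation cmat :: "real mat \<Rightarrow> complex mat" where
  "cmat A \<equiv> map_mat complex_of_real A"

definition rho :: "(nat \<Rightarrow> real) \<Rightarrow> nat \<Rightarrow> real" where
  "rho h n = spectral_radius (cmat (M_mat h n))"

(* The rank one matrix x y^T. *)
definition outer_mat :: "real vec \<Rightarrow> real vec \<Rightarrow> real mat" where
  "outer_mat x y = transpose_mat (mat_of_row x) * mat_of_row y"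

(* Convergence of matrices of fixed size d x d, entry by entry. *)
definition mat_tendsto :: "nat \<Rightarrow> (nat \<Rightarrow> real mat) \<Rightarrow> real mat \<Rightarrow> bool" where
  "mat_tendsto d A L \<longleftrightarrow> (\<forall>m. A m \<in> carrier_mat d d) \<and> L \<in> carrier_mat d d \<and>
     (\<forall>i<d. \<forall>j<d. (\<lambda>m. A m $$ (i, j)) \<longlonglongrightarrow> L $$ (i, j))"

end

theory Submission
  imports Defs
begin

text \<open>
  A modified recurrence shows \<open>c n \<ge> 2 c (n - 1)\<close> for \<open>n \<ge> 3\<close>, so all \<open>c n\<close> are positive, the
  Hessenberg matrix is positive on and below its first superdiagonal, and its power \<open>n - 1\<close> is
  positive.

  The Perron vector of a primitive matrix \<open>A\<close> with spectral radius \<open>r\<close> is \<open>|v|\<close>, for a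
  complex eigenvector \<open>v\<close> of an eigenvalue of modulus \<open>r\<close>: by the triangle inequality
  \<open>A |v| \<ge> r |v|\<close>, and a strict inequality somewhere would be spread by \<open>A ^ k\<close> to all
  components, forcing powers of \<open>A\<close> to grow faster than \<open>r ^ m\<close>. The transpose yields \<open>y\<close>.
  Equality in the triangle inequality makes every peripheral eigenvector a multiple of its
  modulus, hence not orthogonal to \<open>y\<close>; so the deflated matrix \<open>A / r - x y\<^sup>T\<close> has spectral
  radius below 1, and its powers \<open>(A / r) ^ m - x y\<^sup>T\<close> tend to zero. Taking traces,
  the multiplicity of \<open>r\<close> is \<open>y\<^sup>T x = 1\<close>.
\<close>

section \<open>Positivity of the sequence c\<close>

lemma sigma_nonneg: "sigma k \<ge> 0"
  unfolding sigma_def by (rule sum_nonneg) simp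

text \<open>The divisors of a positive \<open>k\<close> lie among \<open>0, ..., k\<close>, so
  \<open>sigma k\<close> is at most the \<open>k\<close>-th triangular number. The factor 2 avoids
  division in the integers.\<close>

lemma two_sigma_le: "2 * sigma k \<le> int k * (int k + 1)"
proof (cases "k = 0")
  case True
  \<comment> \<open>Every natural number divides 0, and a sum over an infinite set is 0 by
    convention.\<close>
  then show ?thesis by (simp add: sigma_def)
next
  case False
  have "sigma k \<le> (\<Sum>d\<in>{0..k}. int d)"
    unfolding sigma_def using False by (intro sum_mono2) (auto dest: dvd_imp_le)
  moreover have "2 * (\<Sum>d\<in>{0..k}. int d) = int k * (int k + 1)"
    using double_gauss_sum[of k, where 'a = int] by simp
  ultimately show ?thesis by simp
qed

text \<open>A list that the simplifier can unfold, for evaluating \<open>sigma\<close> at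
  numerals.\<close>

lemma sigma_eq_sum_list:
  assumes "k > 0"
  shows "sigma k = (\<Sum>d\<leftarrow>[1..<Suc k]. if d dvd k then int d else 0)"
proof -
  have "(\<Sum>d\<leftarrow>[1..<Suc k]. if d dvd k then int d else 0) =
        (\<Sum>d\<in>{1..<Suc k}. if d dvd k then int d else 0)"
    by (subst sum_list_distinct_conv_sum_set) (simp_all del: upt_Suc)
  also have "\<dots> = (\<Sum>d\<in>{d \<in> {1..<Suc k}. d dvd k}. int d)"
    by (rule sum.inter_filter[symmetric]) simp
  also have "{d \<in> {1..<Suc k}. d dvd k} = {d. d dvd k}"
    using assms by (auto simp: Suc_le_eq dest: dvd_imp_le intro!: gr0I)
  finally show ?thesis by (simp add: sigma_def)
qed

definition alt_sigma :: "nat \<Rightarrow> int" where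
  "alt_sigma m = (-1) ^ m * sigma (m + 1)"

lemma alt_sigma_values:
  "alt_sigma 0 = 1" "alt_sigma 1 = -3" "alt_sigma 2 = 4" "alt_sigma 3 = -7"
  "alt_sigma 4 = 6" "alt_sigma 5 = -12" "alt_sigma 6 = 8" "alt_sigma 7 = -15"
  "alt_sigma 8 = 13" "alt_sigma 9 = -18" "alt_sigma 10 = 12"
  unfolding alt_sigma_def
  by (simp_all add: sigma_eq_sum_list upt_conv_Cons numeral_2_eq_2[symmetric])

text \<open>This is the defining recurrence with all terms on one side:
  \<open>alt_sigma 0 = 1\<close> yields \<open>c_seq n\<close>, and the sign of
  \<open>alt_sigma (n - k)\<close> is opposite to that in the recurrence.\<close>

lemma c_seq_convolution:
  assumes "n \<ge> 1"
  shows "(\<Sum>j\<le>n. alt_sigma j * c_seq (n - j)) = 0"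
proof -
  have "(\<Sum>j\<le>n. alt_sigma j * c_seq (n - j)) = (\<Sum>k\<le>n. alt_sigma (n - k) * c_seq k)"
    by (rule sum.reindex_bij_witness[of _ "\<lambda>k. n - k" "\<lambda>k. n - k"]) auto
  also have "\<dots> = c_seq n + (\<Sum>k<n. alt_sigma (n - k) * c_seq k)"
    using alt_sigma_values(1) by (simp add: lessThan_Suc_atMost[symmetric])
  also have "c_seq n = (\<Sum>k<n. (-1) ^ (n - k + 1) * sigma (n - k + 1) * c_seq k)"
    using assms by (subst c_seq.simps) simp
  also have "\<dots> + (\<Sum>k<n. alt_sigma (n - k) * c_seq k) = 0"
    unfolding sum.distrib[symmetric] by (intro sum.neutral) (auto simp: alt_sigma_def)
  finally show ?thesis .
qed

text \<open>
  With \<open>D(q) = \<Sum> alt_sigma m q^m\<close> the generating function of \<open>c_seq\<close> is \<open>1 / D\<close>. The signs of the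
  coefficients of \<open>D\<close> alternate, so the defining recurrence is useless for positivity; the
  multiplier \<open>1 + q - q\<^sup>2\<close> is chosen so that
  \<open>(1 + q - q\<^sup>2) D(q) = 1 - 2 q - 5 q^4 + q^5 - \<dots>\<close>, whose tail is dominated at \<open>q = 1/2\<close> by
  the term \<open>5 q^4\<close>.
\<close>

definition rec_coeff :: "nat \<Rightarrow> int" where
  "rec_coeff j = alt_sigma (j - 2) - alt_sigma (j - 1) - alt_sigma j"

text \<open>Add the convolution identities at \<open>n\<close> and \<open>n - 1\<close> and subtract
  the one at \<open>n - 2\<close>; \<open>n \<ge> 3\<close> makes all three available. The
  coefficients of \<open>c_seq (n - 2)\<close> and \<open>c_seq (n - 3)\<close> cancel.\<close>

lemma c_seq_rec:
  assumes "n \<ge> 3"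
  shows "c_seq n = 2 * c_seq (n - 1) + (\<Sum>j=4..n. rec_coeff j * c_seq (n - j))"
proof -
  have E0: "{..n} = {0, 1, 2, 3} \<union> {4..n}"
    using assms by auto
  have R0: "alt_sigma 0 * c_seq n + alt_sigma 1 * c_seq (n - 1) + alt_sigma 2 * c_seq (n - 2) +
      alt_sigma 3 * c_seq (n - 3) + (\<Sum>j=4..n. alt_sigma j * c_seq (n - j)) = 0"
  proof -
    have "(\<Sum>j\<in>{0, 1, 2, 3} \<union> {4..n}. alt_sigma j * c_seq (n - j)) = 0"
      using c_seq_convolution[of n] assms unfolding E0 by simp
    then show ?thesis by (subst (asm) sum.union_disjoint) auto
  qed
  \<comment> \<open>The shifted identities are reindexed by the distance \<open>j\<close> from
    \<open>n\<close>, so that all three remainders range over \<open>{4..n}\<close>.\<close>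
  have "(\<Sum>j\<le>n - 1. alt_sigma j * c_seq (n - 1 - j)) = 0"
    using c_seq_convolution[of "n - 1"] assms by simp
  also have "(\<Sum>j\<le>n - 1. alt_sigma j * c_seq (n - 1 - j)) =
      (\<Sum>j=1..n. alt_sigma (j - 1) * c_seq (n - j))"
    using assms by (intro sum.reindex_bij_witness[of _ "\<lambda>k. k - 1" "\<lambda>k. k + 1"]) auto
  also have "{1..n} = {1, 2, 3} \<union> {4..n}"
    using assms by auto
  finally have R1: "alt_sigma 0 * c_seq (n - 1) + alt_sigma 1 * c_seq (n - 2) +
      alt_sigma 2 * c_seq (n - 3) + (\<Sum>j=4..n. alt_sigma (j - 1) * c_seq (n - j)) = 0"
    using assms by (subst (asm) sum.union_disjoint) auto
  have "(\<Sum>j\<le>n - 2. alt_sigma j * c_seq (n - 2 - j)) = 0"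
    using c_seq_convolution[of "n - 2"] assms by simp
  also have "(\<Sum>j\<le>n - 2. alt_sigma j * c_seq (n - 2 - j)) =
      (\<Sum>j=2..n. alt_sigma (j - 2) * c_seq (n - j))"
    using assms by (intro sum.reindex_bij_witness[of _ "\<lambda>k. k - 2" "\<lambda>k. k + 2"]) auto
  also have "{2..n} = {2, 3} \<union> {4..n}"
    using assms by auto
  finally have R2: "alt_sigma 0 * c_seq (n - 2) + alt_sigma 1 * c_seq (n - 3) +
      (\<Sum>j=4..n. alt_sigma (j - 2) * c_seq (n - j)) = 0"
    using assms by (subst (asm) sum.union_disjoint) auto
  have "(\<Sum>j=4..n. rec_coeff j * c_seq (n - j)) =
      (\<Sum>j=4..n. alt_sigma (j - 2) * c_seq (n - j)) -
      (\<Sum>j=4..n. alt_sigma (j - 1) * c_seq (n - j)) - (\<Sum>j=4..n. alt_sigma j * c_seq (n - j))"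
    unfolding rec_coeff_def by (simp add: sum_subtractf algebra_simps)
  then show ?thesis
    using R0 R1 R2 by (simp only: alt_sigma_values)
qed

text \<open>Exact negative parts of \<open>rec_coeff j\<close> for \<open>5 \<le> j \<le> 10\<close>, a crude bound afterwards.\<close>

definition neg_bound :: "nat \<Rightarrow> real" where
  "neg_bound j = (if j = 5 then 1 else if j = 7 then 5 else if j = 9 then 10
     else if j \<le> 10 then 0 else real j ^ 2)"

lemma rec_coeff_ge:
  assumes "j \<ge> 5"
  shows "real_of_int (rec_coeff j) \<ge> - neg_bound j"
proof (cases "j \<le> 10")
  case True
  with assms consider "j = 5" | "j = 6" | "j = 7" | "j = 8" | "j = 9" | "j = 10" by linarith
  then show ?thesis
    by cases (use alt_sigma_values in \<open>simp_all add: rec_coeff_def neg_bound_def\<close>)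
next
  case False
  define i where "i = j - 2"
  have j: "j = i + 2" and i: "i \<ge> 9" using False by (auto simp: i_def)
  have b: "2 * sigma (i + 1) \<le> (int i + 1) * (int i + 2)"
    "2 * sigma (i + 2) \<le> (int i + 2) * (int i + 3)"
    "2 * sigma (i + 3) \<le> (int i + 3) * (int i + 4)"
    using two_sigma_le[of "i + 1"] two_sigma_le[of "i + 2"] two_sigma_le[of "i + 3"]
    by (simp_all add: algebra_simps)
  have nn: "sigma (i + 1) \<ge> 0" "sigma (i + 2) \<ge> 0" "sigma (i + 3) \<ge> 0"
    by (rule sigma_nonneg)+
  have "rec_coeff j = (-1) ^ i * (sigma (i + 1) + sigma (i + 2) - sigma (i + 3))"
    by (simp add: rec_coeff_def alt_sigma_def j algebra_simps numeral_3_eq_3)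
  then have "\<bar>rec_coeff j\<bar> = \<bar>sigma (i + 1) + sigma (i + 2) - sigma (i + 3)\<bar>"
    by (simp add: abs_mult)
  \<comment> \<open>All three values are nonnegative, so the modulus is at most the larger of
    \<open>sigma (i + 1) + sigma (i + 2)\<close> and \<open>sigma (i + 3)\<close>. The triangular
    bounds of the first two add up to exactly \<open>(i + 2) ^ 2\<close>, which also dominates the
    third.\<close>
  also have "\<dots> \<le> (int i + 2) ^ 2"
  proof -
    have "(int i + 3) * (int i + 4) \<le> 2 * (int i + 2) ^ 2"
      using i mult_mono[of 9 "int i" 9 "int i"] by (simp add: power2_eq_square algebra_simps)
    then show ?thesis
      using b nn by (simp add: abs_le_iff power2_eq_square algebra_simps)
  qed
  also have "(int i + 2) ^ 2 = int j ^ 2" by (simp add: j)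
  finally have "- (int j ^ 2) \<le> rec_coeff j" by simp
  then have "- real_of_int (int j ^ 2) \<le> real_of_int (rec_coeff j)"
    by linarith
  then show ?thesis using False by (simp add: neg_bound_def)
qed

lemma neg_bound_nonneg: "neg_bound j \<ge> 0"
  by (simp add: neg_bound_def)

text \<open>The target \<open>25 / 96\<close> is what the growth estimate needs: there the sum is
  multiplied by \<open>96 / 5\<close> and must not exceed \<open>rec_coeff 4 = 5\<close>.\<close>

lemma neg_bound_sum_le: "(\<Sum>j=5..n. neg_bound j / 2 ^ j) \<le> 25 / 96"
proof -
  \<comment> \<open>The tail of \<open>j ^ 2 / 2 ^ j\<close> over \<open>j > n\<close> is
    \<open>(n ^ 2 + 4 n + 6) / 2 ^ n\<close>, and \<open>119 / 512\<close> is the value of the whole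
    series; hence the induction step telescopes.\<close>
  have *: "(\<Sum>j=5..n. neg_bound j / 2 ^ j) \<le> 119 / 512 - (real n ^ 2 + 4 * real n + 6) / 2 ^ n"
    if "n \<ge> 10" for n
    using that
  proof (induction n rule: dec_induct)
    case base
    have "{5..10::nat} = {5, 6, 7, 8, 9, 10}" by auto
    then show ?case by (simp add: neg_bound_def)
  next
    case (step n)
    have "neg_bound (Suc n) = (real n + 1) ^ 2"
      using step.hyps by (simp add: neg_bound_def add.commute)
    then have "neg_bound (Suc n) / 2 ^ Suc n =
        (real n ^ 2 + 4 * real n + 6) / 2 ^ n -
        (real (Suc n) ^ 2 + 4 * real (Suc n) + 6) / 2 ^ Suc n"
      by (simp add: field_simps power2_eq_square)
    moreover have "(\<Sum>j=5..Suc n. neg_bound j / 2 ^ j) =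
        (\<Sum>j=5..n. neg_bound j / 2 ^ j) + neg_bound (Suc n) / 2 ^ Suc n"
      using step.hyps by simp
    ultimately show ?case
      using step.IH by linarith
  qed
  have "(\<Sum>j=5..n. neg_bound j / 2 ^ j) \<le> (\<Sum>j=5..n + 10. neg_bound j / 2 ^ j)"
    by (intro sum_mono2) (auto simp: neg_bound_nonneg)
  also have "\<dots> \<le> 119 / 512 - (real (n + 10) ^ 2 + 4 * real (n + 10) + 6) / 2 ^ (n + 10)"
    by (rule *) simp
  also have "\<dots> \<le> 25 / 96"
  proof -
    have "(real (n + 10) ^ 2 + 4 * real (n + 10) + 6) / 2 ^ (n + 10) \<ge> 0" by simp
    then show ?thesis by linarith
  qed
  finally show ?thesis .
qed

lemma c_seq_values: "c_seq 0 = 1" "c_seq 1 = 3" "c_seq 2 = 5" "c_seq 3 = 10" "c_seq 4 = 25"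
proof -
  show 0: "c_seq 0 = 1" by (subst c_seq.simps) simp
  show 1: "c_seq 1 = 3"
    using c_seq_convolution[of 1] 0 alt_sigma_values by (simp add: atMost_Suc)
  show 2: "c_seq 2 = 5"
    using c_seq_convolution[of 2] 0 1 alt_sigma_values by (simp add: atMost_Suc numeral_2_eq_2)
  show 3: "c_seq 3 = 10"
    using c_seq_rec[of 3] 2 by simp
  show "c_seq 4 = 25"
    using c_seq_rec[of 4] 0 3 alt_sigma_values by (simp add: rec_coeff_def)
qed

text \<open>
  Doubling holds from index 3 on; the factor \<open>6/5\<close> absorbs its failure \<open>c_seq 2 = 5 < 2 * c_seq 1\<close>.
\<close>

lemma c_seq_growth:
  assumes "m \<ge> 1"
  shows "c_seq m > 0 \<and> (\<forall>i\<le>m. 5 * 2 ^ (m - i) * c_seq i \<le> 6 * c_seq m)"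
  using assms
proof (induction m rule: less_induct)
  case (less m)
  consider "m = 1" | "m = 2" | "m \<ge> 3" using less.prems by linarith
  then show ?case
  proof cases
    case 1
    then show ?thesis using c_seq_values by (auto simp: le_Suc_eq)
  next
    case 2
    then show ?thesis using c_seq_values by (auto simp: le_Suc_eq numeral_2_eq_2)
  next
    case 3
    have pos: "c_seq i > 0" if "i < m" for i
      using less.IH[of i] that c_seq_values(1) by (cases "i = 0") auto
    have double: "2 * c_seq (m - 1) \<le> c_seq m"
    proof -
      consider "m = 3" | "m = 4" | "m \<ge> 5" using 3 by linarith
      then show ?thesis
      proof cases
        case 3
        define K where "K = real_of_int (c_seq (m - 4))"
        have "K > 0" using pos[of "m - 4"] 3 by (simp add: K_def)
        \<comment> \<open>The induction hypothesis at \<open>m - 4\<close> gives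
          \<open>c_seq (m - j) \<le> 6/5 * K / 2 ^ (j - 4)\<close>; with
          \<open>2 ^ j = 16 * 2 ^ (j - 4)\<close> this is \<open>96/5 * K / 2 ^ j\<close>.\<close>
        have term_le: "real_of_int (rec_coeff j * c_seq (m - j)) \<ge> - (96 / 5 * K * (neg_bound j / 2 ^ j))"
          if j: "j \<in> {5..m}" for j
        proof -
          have cp: "c_seq (m - j) > 0" using j pos by simp
          have "5 * 2 ^ (j - 4) * c_seq (m - j) \<le> 6 * c_seq (m - 4)"
          proof -
            have "m - 4 - (m - j) = j - 4" using j by auto
            moreover have "m - 4 < m" "m - 4 \<ge> 1" "m - j \<le> m - 4" using j by auto
            ultimately show ?thesis using less.IH[of "m - 4", THEN conjunct2, rule_format, of "m - j"]
              by simp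
          qed
          then have "real_of_int (5 * 2 ^ (j - 4) * c_seq (m - j)) \<le> real_of_int (6 * c_seq (m - 4))"
            by linarith
          moreover have "(2::real) ^ j = 16 * 2 ^ (j - 4)"
            using j power_add[of "2::real" 4 "j - 4"] by simp
          ultimately have "real_of_int (c_seq (m - j)) \<le> 96 / 5 * K / 2 ^ j"
            by (simp add: K_def field_simps)
          then have "neg_bound j * real_of_int (c_seq (m - j)) \<le> neg_bound j * (96 / 5 * K / 2 ^ j)"
            by (intro mult_left_mono neg_bound_nonneg)
          moreover have "- neg_bound j * real_of_int (c_seq (m - j)) \<le>
              real_of_int (rec_coeff j) * real_of_int (c_seq (m - j))"
            using j cp by (intro mult_right_mono rec_coeff_ge) auto
          ultimately show ?thesis by (simp add: mult_ac)
        qed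
        \<comment> \<open>Since \<open>96/5 * 25/96 = 5\<close>, the terms from \<open>j = 5\<close>
          on lose at most \<open>5 * K\<close>, which is exactly the gain of the term
          \<open>j = 4\<close>.\<close>
        have "- 5 * K \<le> - (96 / 5 * K * (\<Sum>j=5..m. neg_bound j / 2 ^ j))"
          using mult_left_mono[OF neg_bound_sum_le[of m], of "96 / 5 * K"] \<open>K > 0\<close> by simp
        also have "\<dots> = (\<Sum>j=5..m. - (96 / 5 * K * (neg_bound j / 2 ^ j)))"
          by (simp only: sum_distrib_left sum_negf)
        also have "\<dots> \<le> (\<Sum>j=5..m. real_of_int (rec_coeff j * c_seq (m - j)))"
          by (intro sum_mono term_le)
        finally have "- 5 * c_seq (m - 4) \<le> (\<Sum>j=5..m. rec_coeff j * c_seq (m - j))"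
          unfolding K_def of_int_sum[symmetric] by linarith
        moreover have "(\<Sum>j=4..m. rec_coeff j * c_seq (m - j)) =
            5 * c_seq (m - 4) + (\<Sum>j=5..m. rec_coeff j * c_seq (m - j))"
          using 3 alt_sigma_values by (subst sum.atLeast_Suc_atMost) (auto simp: rec_coeff_def)
        moreover have "c_seq m = 2 * c_seq (m - 1) + (\<Sum>j=4..m. rec_coeff j * c_seq (m - j))"
          using 3 by (intro c_seq_rec) simp
        ultimately show ?thesis by linarith
      qed (simp_all add: c_seq_values)
    qed
    have "5 * 2 ^ (m - i) * c_seq i \<le> 6 * c_seq m" if i: "i \<le> m" for i
    proof (cases "i = m")
      case True
      then show ?thesis using double pos[of "m - 1"] 3 by simp
    next
      case False
      then have "5 * 2 ^ (m - 1 - i) * c_seq i \<le> 6 * c_seq (m - 1)"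
        using less.IH[of "m - 1", THEN conjunct2, rule_format, of i] 3 i by simp
      moreover have "m - i = Suc (m - 1 - i)" using i False by simp
      then have "5 * 2 ^ (m - i) * c_seq i = 2 * (5 * 2 ^ (m - 1 - i) * c_seq i)"
        by (simp only: power_Suc mult_ac)
      ultimately show ?thesis using double by linarith
    qed
    moreover have "c_seq m > 0"
      using double pos[of "m - 1"] 3 by simp
    ultimately show ?thesis by blast
  qed
qed

lemma c_seq_pos: "c_seq n > 0"
  using c_seq_growth[of n] c_seq_values(1) by (cases "n = 0") auto

section \<open>Matrices and eigenvalues\<close>

lemma mult_mat_vec_nth:
  assumes "A \<in> carrier_mat n m" "v \<in> carrier_vec m" "i < n"
  shows "(A *\<^sub>v v) $ i = (\<Sum>j<m. A $$ (i, j) * v $ j)"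
  using assms by (simp add: scalar_prod_def atLeast0LessThan)

lemma mult_mat_nth:
  assumes "A \<in> carrier_mat n m" "B \<in> carrier_mat m l" "i < n" "j < l"
  shows "(A * B) $$ (i, j) = (\<Sum>k<m. A $$ (i, k) * B $$ (k, j))"
  using assms by (simp add: scalar_prod_def atLeast0LessThan)

lemma pow_mat_comm:
  assumes "A \<in> carrier_mat n n"
  shows "A * A ^\<^sub>m m = A ^\<^sub>m m * A"
proof (induction m)
  case (Suc m)
  then show ?case
    using assms assoc_mult_mat[of A n n "A ^\<^sub>m m" n A n] by simp
qed (use assms in simp)

lemma transpose_pow_mat:
  fixes A :: "'a :: comm_semiring_1 mat"
  assumes "A \<in> carrier_mat n n"
  shows "transpose_mat A ^\<^sub>m m = transpose_mat (A ^\<^sub>m m)"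
proof (induction m)
  case (Suc m)
  then show ?case
    using assms transpose_mult[of A n n "A ^\<^sub>m m" n] by (simp add: pow_mat_comm)
qed (use assms in simp)

lemma smult_pow_mat:
  fixes A :: "'a :: comm_semiring_1 mat"
  assumes "A \<in> carrier_mat n n"
  shows "(a \<cdot>\<^sub>m A) ^\<^sub>m m = a ^ m \<cdot>\<^sub>m A ^\<^sub>m m"
proof (induction m)
  case 0
  then show ?case using assms by (intro eq_matI) auto
next
  case (Suc m)
  have "(a \<cdot>\<^sub>m A) ^\<^sub>m Suc m = (a ^ m \<cdot>\<^sub>m A ^\<^sub>m m) * (a \<cdot>\<^sub>m A)"
    by (simp add: Suc)
  also have "\<dots> = a ^ m \<cdot>\<^sub>m (a \<cdot>\<^sub>m (A ^\<^sub>m m * A))"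
    using assms mult_smult_assoc_mat[of "A ^\<^sub>m m" n n "a \<cdot>\<^sub>m A" n "a ^ m"]
      mult_smult_distrib[of "A ^\<^sub>m m" n n A n a] by simp
  also have "\<dots> = a ^ Suc m \<cdot>\<^sub>m A ^\<^sub>m Suc m"
    by (intro eq_matI) (simp_all add: mult_ac)
  finally show ?case .
qed

lemma cmat_pow_nth:
  assumes "A \<in> carrier_mat n n" "i < n" "j < n"
  shows "(cmat A ^\<^sub>m m) $$ (i, j) = complex_of_real ((A ^\<^sub>m m) $$ (i, j))"
  using assms by (simp flip: of_real_hom.mat_hom_pow)

lemma pow_mat_nonneg:
  fixes A :: "'a :: linordered_semidom mat"
  assumes "A \<in> carrier_mat n n" "\<And>i j. i < n \<Longrightarrow> j < n \<Longrightarrow> A $$ (i, j) \<ge> 0" "i < n" "j < n"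
  shows "(A ^\<^sub>m m) $$ (i, j) \<ge> 0"
  using assms(3,4)
proof (induction m arbitrary: i j)
  case 0
  then show ?case using assms(1) by simp
next
  case (Suc m)
  then show ?case
    using assms(1,2) mult_mat_nth[of "A ^\<^sub>m m" n n A n i j] by (auto intro!: sum_nonneg)
qed

lemma pow_mat_mult_eigen:
  assumes "A \<in> carrier_mat n n" "v \<in> carrier_vec n" "A *\<^sub>v v = (c :: 'a :: comm_ring_1) \<cdot>\<^sub>v v"
  shows "A ^\<^sub>m m *\<^sub>v v = c ^ m \<cdot>\<^sub>v v"
proof (cases "v = 0\<^sub>v n")
  case True
  have "A ^\<^sub>m m *\<^sub>v 0\<^sub>v n = 0\<^sub>v n"
    using assms(1) by (intro eq_vecI) auto
  moreover have "c ^ m \<cdot>\<^sub>v 0\<^sub>v n = 0\<^sub>v n" by (intro eq_vecI) auto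
  ultimately show ?thesis using True by simp
next
  case False
  then have "eigenvector A v c"
    using assms by (simp add: eigenvector_def)
  then show ?thesis by (rule eigenvector_pow[OF assms(1)])
qed

section \<open>Eigenvalues and decay of powers\<close>

lemma eigenvalueI:
  assumes "A \<in> carrier_mat n n" "v \<in> carrier_vec n" "v \<noteq> 0\<^sub>v n" "A *\<^sub>v v = c \<cdot>\<^sub>v v"
  shows "eigenvalue A c"
  using assms unfolding eigenvalue_def eigenvector_def by auto

lemma eigenvalueE:
  assumes "eigenvalue A c" "A \<in> carrier_mat n n"
  obtains v where "v \<in> carrier_vec n" "v \<noteq> 0\<^sub>v n" "A *\<^sub>v v = c \<cdot>\<^sub>v v"
  using assms unfolding eigenvalue_def eigenvector_def by auto

lemma eigenvalue_smultD:
  fixes A :: "'a :: field mat"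
  assumes "A \<in> carrier_mat n n" "eigenvalue (a \<cdot>\<^sub>m A) c" "a \<noteq> 0"
  shows "eigenvalue A (c / a)"
proof -
  obtain v where v: "v \<in> carrier_vec n" "v \<noteq> 0\<^sub>v n" "(a \<cdot>\<^sub>m A) *\<^sub>v v = c \<cdot>\<^sub>v v"
    using eigenvalueE[OF assms(2), of n] assms(1) by auto
  have "A *\<^sub>v v = (c / a) \<cdot>\<^sub>v v"
  proof (rule eq_vecI)
    fix i assume "i < dim_vec ((c / a) \<cdot>\<^sub>v v)"
    then have i: "i < n" using v by simp
    have "a * (A *\<^sub>v v) $ i = ((a \<cdot>\<^sub>m A) *\<^sub>v v) $ i"
      using assms(1) v(1) i by simp
    also have "\<dots> = c * v $ i"
      unfolding v(3) using v(1) i by simp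
    finally show "(A *\<^sub>v v) $ i = ((c / a) \<cdot>\<^sub>v v) $ i"
      using v(1) i assms(3) by (simp add: field_simps del: index_mult_mat_vec)
  qed (use v assms(1) in auto)
  then show ?thesis using v assms(1) by (intro eigenvalueI)
qed

text \<open>Choose \<open>t\<close> strictly between the spectral radius and 1. Then
  \<open>B = A / t\<close> still has spectral radius below 1, so its powers are bounded, and
  \<open>A ^ m = t ^ m B ^ m\<close> tends to zero.\<close>

lemma pow_mat_tendsto_0:
  fixes A :: "complex mat"
  assumes A: "A \<in> carrier_mat n n" and ev: "\<And>c. eigenvalue A c \<Longrightarrow> cmod c < 1"
    and ij: "i < n" "j < n"
  shows "(\<lambda>m. (A ^\<^sub>m m) $$ (i, j)) \<longlonglongrightarrow> 0"
proof -
  have n: "n > 0" using ij by simp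
  obtain c where c: "eigenvalue A c" "spectral_radius A = cmod c"
    using spectral_radius_mem_max(1)[OF A n] by (auto simp: spectrum_def)
  have "cmod c < 1" using ev c by blast
  then obtain t where t: "cmod c < t" "t < 1" using dense by blast
  have t0: "t > 0" using t norm_ge_zero[of c] by linarith
  define B where "B = complex_of_real (1 / t) \<cdot>\<^sub>m A"
  have B: "B \<in> carrier_mat n n" using A by (simp add: B_def)
  obtain b where b: "eigenvalue B b" "spectral_radius B = cmod b"
    using spectral_radius_mem_max(1)[OF B n] by (auto simp: spectrum_def)
  have "eigenvalue A (b / complex_of_real (1 / t))"
    using eigenvalue_smultD[OF A b(1)[unfolded B_def]] t0 by simp
  then have "cmod (b / complex_of_real (1 / t)) \<in> norm ` spectrum A"
    by (simp add: spectrum_def)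
  from spectral_radius_mem_max(2)[OF A n this]
  have "cmod b * t \<le> cmod c"
    using t0 c by (simp add: norm_mult norm_divide)
  then have "cmod b * t < 1 * t"
    using t by linarith
  then have "spectral_radius B < 1" using t0 b by (simp only: mult_less_cancel_right_pos)
  then obtain K where K: "\<And>m. norm_bound (B ^\<^sub>m m) K"
    using spectral_radius_jnf_norm_bound_less_1_upper_triangular[OF B] by blast
  have "A = complex_of_real t \<cdot>\<^sub>m B"
    using t0 by (intro eq_matI) (auto simp: B_def)
  then have "A ^\<^sub>m m = complex_of_real t ^ m \<cdot>\<^sub>m B ^\<^sub>m m" for m
    by (simp add: smult_pow_mat[OF B])
  then have eq: "cmod ((A ^\<^sub>m m) $$ (i, j)) = t ^ m * cmod ((B ^\<^sub>m m) $$ (i, j))" for m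
    using B ij t0 by (simp add: norm_mult norm_power)
  have "cmod ((A ^\<^sub>m m) $$ (i, j)) \<le> t ^ m * K" for m
  proof -
    have "cmod ((B ^\<^sub>m m) $$ (i, j)) \<le> K"
      using K[of m] B ij by (simp add: norm_bound_def)
    then show ?thesis using t0 by (simp add: eq)
  qed
  moreover have "(\<lambda>m. t ^ m * K) \<longlonglongrightarrow> 0"
    using t t0 by (intro tendsto_mult_left_zero LIMSEQ_power_zero) simp
  ultimately show ?thesis
    by (rule Lim_null_comparison[OF always_eventually[OF allI]])
qed

text \<open>Let \<open>c\<close> be the direction of the sum. After rotation by \<open>cnj c\<close>
  the sum is real, so the nonnegative gaps \<open>|v j| - Re (cnj c * v j)\<close>, with positive
  weights, add up to zero; hence every \<open>cnj c * v j\<close> is real and nonnegative. If the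
  sum is zero, all \<open>v j\<close> vanish.\<close>

lemma weighted_triangle_equality:
  fixes v :: "'a \<Rightarrow> complex"
  assumes fin: "finite J" and a: "\<And>j. j \<in> J \<Longrightarrow> a j > 0"
    and eq: "cmod (\<Sum>j\<in>J. complex_of_real (a j) * v j) = (\<Sum>j\<in>J. a j * cmod (v j))"
  shows "\<exists>c. \<forall>j\<in>J. v j = c * complex_of_real (cmod (v j))"
proof (cases "(\<Sum>j\<in>J. complex_of_real (a j) * v j) = 0")
  case True
  then have "(\<Sum>j\<in>J. a j * cmod (v j)) = 0" using eq by simp
  then have "\<forall>j\<in>J. a j * cmod (v j) = 0"
    using fin a less_imp_le[OF a] sum_nonneg_eq_0_iff[OF fin, of "\<lambda>j. a j * cmod (v j)"] by simp
  then show ?thesis using a by (intro exI[of _ 0]) force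
next
  case False
  define S where "S = (\<Sum>j\<in>J. complex_of_real (a j) * v j)"
  define c where "c = sgn S"
  have cc: "c * cnj c = 1"
    using False by (simp add: c_def S_def norm_sgn flip: complex_norm_square)
  have "S = cmod S * c"
    using False by (simp add: c_def S_def sgn_eq)
  then have "cnj c * S = cnj c * (cmod S * c)" by (rule arg_cong)
  also have "\<dots> = c * cnj c * cmod S" by (simp only: mult_ac)
  finally have "cnj c * S = cmod S" by (simp only: cc mult_1)
  then have "Re (cnj c * S) = (\<Sum>j\<in>J. a j * cmod (v j))"
    using eq by (simp add: S_def)
  moreover have "Re (cnj c * S) = (\<Sum>j\<in>J. a j * Re (cnj c * v j))"
    unfolding S_def sum_distrib_left Re_sum
    by (intro sum.cong refl) (simp add: algebra_simps)
  ultimately have "(\<Sum>j\<in>J. a j * (cmod (v j) - Re (cnj c * v j))) = 0"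
    by (simp add: right_diff_distrib sum_subtractf)
  moreover have norm_eq: "cmod (cnj c * v j) = cmod (v j)" for j
    using False by (simp add: norm_mult c_def S_def norm_sgn)
  moreover have "a j * (cmod (v j) - Re (cnj c * v j)) \<ge> 0" if "j \<in> J" for j
    using less_imp_le[OF a[OF that]] complex_Re_le_cmod[of "cnj c * v j"]
    by (intro mult_nonneg_nonneg) (simp_all only: norm_eq[of j] diff_ge_0_iff_ge)
  ultimately have "\<forall>j\<in>J. a j * (cmod (v j) - Re (cnj c * v j)) = 0"
    using sum_nonneg_eq_0_iff[OF fin, of "\<lambda>j. a j * (cmod (v j) - Re (cnj c * v j))"] by blast
  then have Re_eq: "Re (cnj c * v j) = cmod (cnj c * v j)" if "j \<in> J" for j
    using a[OF that] that by (auto simp: norm_eq)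
  have "v j = c * complex_of_real (cmod (v j))" if "j \<in> J" for j
  proof -
    have "cnj c * v j = complex_of_real (cmod (v j))"
    proof (rule complex_eqI)
      show "Re (cnj c * v j) = Re (complex_of_real (cmod (v j)))"
        using Re_eq[OF that] by (simp only: norm_eq Re_complex_of_real)
      \<comment> \<open>A number whose real part equals its modulus has no imaginary part.\<close>
      have "(Im (cnj c * v j))\<^sup>2 = 0"
        using cmod_power2[of "cnj c * v j"] unfolding Re_eq[OF that] by linarith
      then show "Im (cnj c * v j) = Im (complex_of_real (cmod (v j)))"
        by (simp only: power_eq_0_iff Im_complex_of_real)
    qed
    then have "c * (cnj c * v j) = c * complex_of_real (cmod (v j))" by (rule arg_cong)
    then show ?thesis by (simp only: mult.assoc[symmetric] cc mult_1)
  qed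
  then show ?thesis by blast
qed

section \<open>Traces of powers and algebraic multiplicity\<close>

lemma trace_mult_comm:
  fixes A B :: "'a :: comm_semiring_0 mat"
  assumes "A \<in> carrier_mat n m" "B \<in> carrier_mat m n"
  shows "(\<Sum>i<n. (A * B) $$ (i, i)) = (\<Sum>j<m. (B * A) $$ (j, j))"
proof -
  have "(\<Sum>i<n. (A * B) $$ (i, i)) = (\<Sum>i<n. \<Sum>j<m. A $$ (i, j) * B $$ (j, i))"
    using assms by (intro sum.cong refl mult_mat_nth) auto
  also have "\<dots> = (\<Sum>j<m. \<Sum>i<n. A $$ (i, j) * B $$ (j, i))"
    by (rule sum.swap)
  also have "\<dots> = (\<Sum>j<m. (B * A) $$ (j, j))"
    using assms by (intro sum.cong refl) (simp add: mult_mat_nth[of B m n A m] mult.commute del: index_mult_mat)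
  finally show ?thesis .
qed

lemma upper_triangular_pow_mat:
  fixes A :: "'a :: comm_semiring_1 mat"
  assumes A: "A \<in> carrier_mat n n" and ut: "\<And>i j. i < n \<Longrightarrow> j < i \<Longrightarrow> A $$ (i, j) = 0"
    and ij: "i < n" "j \<le> i"
  shows "(A ^\<^sub>m m) $$ (i, j) = (if j = i then A $$ (i, i) ^ m else 0)"
  using ij
proof (induction m arbitrary: i j)
  case 0
  then show ?case using A by simp
next
  case (Suc m)
  have "(A ^\<^sub>m Suc m) $$ (i, j) = (\<Sum>k<n. (A ^\<^sub>m m) $$ (i, k) * A $$ (k, j))"
    using A Suc.prems by (simp add: mult_mat_nth[of "A ^\<^sub>m m" n n A n] del: index_mult_mat)
  \<comment> \<open>For \<open>k < i\<close> the first factor vanishes by induction; for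
    \<open>k > i\<close> the second one lies below the diagonal, because
    \<open>j \<le> i < k\<close>.\<close>
  also have "\<dots> = (\<Sum>k<n. if k = i then A $$ (i, i) ^ m * A $$ (i, j) else 0)"
  proof (intro sum.cong refl)
    fix k assume "k \<in> {..<n}"
    then show "(A ^\<^sub>m m) $$ (i, k) * A $$ (k, j) =
        (if k = i then A $$ (i, i) ^ m * A $$ (i, j) else 0)"
      using Suc.IH[of i k] Suc.prems ut[of k j] by (cases k i rule: linorder_cases) auto
  qed
  also have "\<dots> = A $$ (i, i) ^ m * A $$ (i, j)"
    using Suc.prems by simp
  also have "\<dots> = (if j = i then A $$ (i, i) ^ Suc m else 0)"
    using Suc.prems ut[of i j] by (auto simp: mult.commute)
  finally show ?case .
qed

text \<open>Schur decomposition makes \<open>A\<close> similar to an upper triangular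
  \<open>B\<close> with diagonal \<open>es\<close>. Powers and the trace respect the similarity, and
  the diagonal of \<open>B ^ m\<close> consists of the \<open>m\<close>-th powers.\<close>

lemma trace_pow_mat:
  fixes A :: "complex mat"
  assumes A: "A \<in> carrier_mat n n" and es: "char_poly A = (\<Prod>a\<leftarrow>es. [:- a, 1:])"
  shows "(\<Sum>i<n. (A ^\<^sub>m m) $$ (i, i)) = (\<Sum>a\<leftarrow>es. a ^ m)"
proof -
  obtain B P Q where "schur_decomposition A es = (B, P, Q)"
    by (cases "schur_decomposition A es") auto
  from schur_decomposition[OF A es this]
  have wit: "similar_mat_wit A B P Q" and ut: "upper_triangular B" and diag: "diag_mat B = es"
    by auto
  have carr: "B \<in> carrier_mat n n" "P \<in> carrier_mat n n" "Q \<in> carrier_mat n n"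
    and QP: "Q * P = 1\<^sub>m n"
    using wit A by (auto simp: similar_mat_wit_def Let_def)
  have "(\<Sum>i<n. (A ^\<^sub>m m) $$ (i, i)) = (\<Sum>i<n. (P * B ^\<^sub>m m * Q) $$ (i, i))"
    by (simp add: similar_mat_wit_pow_id[OF wit])
  also have "\<dots> = (\<Sum>i<n. (Q * (P * B ^\<^sub>m m)) $$ (i, i))"
    using carr by (intro trace_mult_comm) auto
  also have "Q * (P * B ^\<^sub>m m) = B ^\<^sub>m m"
    using carr QP assoc_mult_mat[of Q n n P n "B ^\<^sub>m m" n] by simp
  also have "(\<Sum>i<n. (B ^\<^sub>m m) $$ (i, i)) = (\<Sum>i<n. (B $$ (i, i)) ^ m)"
    using carr ut by (intro sum.cong refl) (subst upper_triangular_pow_mat[of B n]; auto)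
  also have "\<dots> = (\<Sum>a\<leftarrow>es. a ^ m)"
    using carr unfolding diag[symmetric] diag_mat_def
    by (simp add: o_def interv_sum_list_conv_sum_set_nat atLeast0LessThan)
  finally show ?thesis .
qed

text \<open>Turns algebraic multiplicity into a count of eigenvalues, which is what the limit of the
  traces measures.\<close>

lemma order_prod_linear:
  "order c (\<Prod>a\<leftarrow>es. [:- a, 1:]) = length (filter ((=) c) (es :: 'a :: idom list))"
proof (induction es)
  case (Cons a es)
  have "(\<Prod>a\<leftarrow>es. [:- a, 1:]) \<noteq> 0" by (auto simp: prod_list_zero_iff)
  then show ?case
    using Cons by (simp add: order_mult order_linear' del: mult_pCons_left mult_pCons_right)
qed (simp add: order_1_eq_0)

section \<open>Perron-Frobenius theory of primitive matrices\<close>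

text \<open>The exponent \<open>k\<close> is a parameter, so that the transpose satisfies the same
  locale with the same exponent; \<open>d > 0\<close> keeps the spectrum nonempty.\<close>

locale primitive_matrix =
  fixes A :: "real mat" and d k :: nat
  assumes carrier: "A \<in> carrier_mat d d" and d_pos: "d > 0" and k_pos: "k > 0"
    and nonneg: "\<And>i j. i < d \<Longrightarrow> j < d \<Longrightarrow> A $$ (i, j) \<ge> 0"
    and pow_pos: "\<And>i j. i < d \<Longrightarrow> j < d \<Longrightarrow> (A ^\<^sub>m k) $$ (i, j) > 0"
begin

abbreviation r :: real where
  "r \<equiv> spectral_radius (cmat A)"

lemma cmat_carrier: "cmat A \<in> carrier_mat d d"
  using carrier by simp

lemma eigenvalue_cmod_le:
  assumes "eigenvalue (cmat A) c"
  shows "cmod c \<le> r"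
  using spectral_radius_mem_max(2)[OF cmat_carrier d_pos, of "cmod c"] assms
  by (simp add: spectrum_def)

lemma max_eigenvalue:
  obtains c where "eigenvalue (cmat A) c" "cmod c = r"
  using spectral_radius_mem_max(1)[OF cmat_carrier d_pos] by (auto simp: spectrum_def)

lemma r_nonneg: "r \<ge> 0"
  using max_eigenvalue by (metis norm_ge_zero)

lemma pow_mult_pos:
  fixes u :: "real vec"
  assumes u: "u \<in> carrier_vec d" "\<And>i. i < d \<Longrightarrow> u $ i \<ge> 0"
    and j: "j < d" "u $ j > 0" and i: "i < d"
  shows "(A ^\<^sub>m k *\<^sub>v u) $ i > 0"
proof -
  have "(A ^\<^sub>m k *\<^sub>v u) $ i = (\<Sum>j<d. (A ^\<^sub>m k) $$ (i, j) * u $ j)"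
    using carrier u i by (intro mult_mat_vec_nth) auto
  also have "\<dots> > 0"
  proof (rule sum_pos2[where i = j])
    show "(A ^\<^sub>m k) $$ (i, l) * u $ l \<ge> 0" if "l \<in> {..<d}" for l
      using that u(2)[of l] pow_pos[OF i, of l] by (intro mult_nonneg_nonneg) auto
  qed (use j pow_pos[OF i j(1)] in auto)
  finally show ?thesis .
qed

text \<open>\<open>(A / s) ^ m\<close> tends to zero, whereas \<open>(A / s) ^ m u \<ge> u\<close> for all \<open>m\<close>.\<close>

lemma no_growth:
  fixes u :: "real vec"
  assumes s: "s > r" and u: "u \<in> carrier_vec d" "\<And>i. i < d \<Longrightarrow> u $ i > 0"
    and ge: "\<And>i. i < d \<Longrightarrow> (A *\<^sub>v u) $ i \<ge> s * u $ i"
  shows False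
proof -
  have s0: "s > 0" using s r_nonneg by linarith
  define E where "E = (1 / s) \<cdot>\<^sub>m A"
  have E: "E \<in> carrier_mat d d" using carrier by (simp add: E_def)
  have E_nonneg: "E $$ (i, j) \<ge> 0" if "i < d" "j < d" for i j
    using that carrier nonneg s0 by (simp add: E_def)
  have E_u: "(E *\<^sub>v u) $ i \<ge> u $ i" if "i < d" for i
  proof -
    have "(E *\<^sub>v u) $ i = (1 / s) * (A *\<^sub>v u) $ i"
      using that carrier u by (simp add: E_def)
    then have "s * (E *\<^sub>v u) $ i \<ge> s * u $ i"
      using ge[OF that] s0 by (simp del: index_mult_mat_vec)
    then show ?thesis using s0 by (simp only: mult_le_cancel_left_pos)
  qed
  have pow_u: "(E ^\<^sub>m m *\<^sub>v u) $ i \<ge> u $ i" if i: "i < d" for m i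
  proof (induction m)
    case 0
    then show ?case using E u i by simp
  next
    case (Suc m)
    \<comment> \<open>The nonnegative matrix \<open>E ^ m\<close> preserves the componentwise
      inequality \<open>u \<le> E u\<close>.\<close>
    have "(E ^\<^sub>m m *\<^sub>v u) $ i \<le> (E ^\<^sub>m m *\<^sub>v (E *\<^sub>v u)) $ i"
    proof -
      have "(E ^\<^sub>m m *\<^sub>v u) $ i = (\<Sum>j<d. (E ^\<^sub>m m) $$ (i, j) * u $ j)"
        using E u i by (intro mult_mat_vec_nth) auto
      also have "\<dots> \<le> (\<Sum>j<d. (E ^\<^sub>m m) $$ (i, j) * (E *\<^sub>v u) $ j)"
        using E E_nonneg E_u i
        by (intro sum_mono mult_left_mono) (auto intro: pow_mat_nonneg[OF E] simp del: index_mult_mat_vec)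
      also have "\<dots> = (E ^\<^sub>m m *\<^sub>v (E *\<^sub>v u)) $ i"
        using E u i by (intro mult_mat_vec_nth[symmetric]) auto
      finally show ?thesis .
    qed
    also have "\<dots> = (E ^\<^sub>m Suc m *\<^sub>v u) $ i"
      using E u by (simp add: assoc_mult_mat_vec[of "E ^\<^sub>m m" d d E d u])
    finally show ?case using Suc by linarith
  qed
  have ev: "cmod c < 1" if "eigenvalue (cmat E) c" for c
  proof -
    have "cmat E = complex_of_real (1 / s) \<cdot>\<^sub>m cmat A"
      by (intro eq_matI) (auto simp: E_def)
    with that have "eigenvalue (cmat A) (c / complex_of_real (1 / s))"
      using eigenvalue_smultD[OF cmat_carrier, of "complex_of_real (1 / s)" c] s0 by simp
    from eigenvalue_cmod_le[OF this] have "cmod c * s \<le> r"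
      using s0 by (simp add: norm_mult norm_divide)
    then have "cmod c * s < 1 * s" using s by linarith
    then show ?thesis using s0 by (simp only: mult_less_cancel_right_pos)
  qed
  have lim: "(\<lambda>m. (E ^\<^sub>m m) $$ (0, j)) \<longlonglongrightarrow> 0" if j: "j < d" for j
  proof -
    have "(\<lambda>m. (cmat E ^\<^sub>m m) $$ (0, j)) \<longlonglongrightarrow> 0"
      using E d_pos j ev by (intro pow_mat_tendsto_0[of _ d]) auto
    moreover have "(cmat E ^\<^sub>m m) $$ (0, j) = complex_of_real ((E ^\<^sub>m m) $$ (0, j))" for m
      using E d_pos j by (rule cmat_pow_nth)
    ultimately show ?thesis
      by (simp add: tendsto_of_real_iff[where c = 0 and 'a = complex, simplified])
  qed
  have "(\<lambda>m. \<Sum>j<d. (E ^\<^sub>m m) $$ (0, j) * u $ j) \<longlonglongrightarrow> (\<Sum>j<d. 0 * u $ j)"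
    by (intro tendsto_intros lim) simp
  moreover have "(\<Sum>j<d. (E ^\<^sub>m m) $$ (0, j) * u $ j) = (E ^\<^sub>m m *\<^sub>v u) $ 0" for m
    using E u d_pos by (intro mult_mat_vec_nth[symmetric]) auto
  ultimately have "(\<lambda>m. (E ^\<^sub>m m *\<^sub>v u) $ 0) \<longlonglongrightarrow> 0" by simp
  moreover have "\<forall>m. (E ^\<^sub>m m *\<^sub>v u) $ 0 \<ge> u $ 0"
    using pow_u d_pos by blast
  ultimately have "u $ 0 \<le> 0"
    by (meson LIMSEQ_le_const)
  then show False using u(2)[OF d_pos] by simp
qed

text \<open>If \<open>w = A u - r u\<close> were nonzero, \<open>A ^ k w\<close> would be positive.
  As \<open>A ^ k\<close> commutes with \<open>A\<close>, the vector \<open>z = A ^ k u\<close>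
  would satisfy \<open>A z > r z\<close> in every component, hence \<open>A z \<ge> s z\<close> for
  some \<open>s > r\<close>, contradicting \<open>no_growth\<close>.\<close>

lemma subinvariant_imp_invariant:
  fixes u :: "real vec"
  assumes u: "u \<in> carrier_vec d" "\<And>i. i < d \<Longrightarrow> u $ i \<ge> 0" "u \<noteq> 0\<^sub>v d"
    and ge: "\<And>i. i < d \<Longrightarrow> (A *\<^sub>v u) $ i \<ge> r * u $ i"
  shows "A *\<^sub>v u = r \<cdot>\<^sub>v u" "\<And>i. i < d \<Longrightarrow> u $ i > 0" "r > 0"
proof -
  have "\<exists>j<d. u $ j \<noteq> 0"
  proof (rule ccontr)
    assume "\<not> ?thesis"
    then have "u = 0\<^sub>v d" using u(1) by (intro eq_vecI) auto
    then show False using u(3) by simp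
  qed
  then obtain j where j: "j < d" "u $ j > 0" using u(2) by force
  define z where "z = A ^\<^sub>m k *\<^sub>v u"
  have z: "z \<in> carrier_vec d"
    unfolding z_def using carrier u by (intro mult_mat_vec_carrier[of _ d d]) auto
  have z_pos: "z $ i > 0" if "i < d" for i
    unfolding z_def using u j that by (intro pow_mult_pos[where j = j]) auto
  show inv: "A *\<^sub>v u = r \<cdot>\<^sub>v u"
  proof (rule ccontr)
    assume neq: "A *\<^sub>v u \<noteq> r \<cdot>\<^sub>v u"
    define w where "w = A *\<^sub>v u - r \<cdot>\<^sub>v u"
    have Au: "A *\<^sub>v u \<in> carrier_vec d" using carrier u by simp
    have w: "w \<in> carrier_vec d" using carrier u by (simp add: w_def)
    have w_nth: "w $ i = (A *\<^sub>v u) $ i - r * u $ i" if "i < d" for i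
      using that carrier u by (simp add: w_def)
    have "\<exists>l<d. (A *\<^sub>v u) $ l \<noteq> r * u $ l"
    proof (rule ccontr)
      assume "\<not> ?thesis"
      then have "A *\<^sub>v u = r \<cdot>\<^sub>v u" using u(1) Au carrier by (intro eq_vecI) auto
      then show False using neq by simp
    qed
    then obtain l where l: "l < d" "w $ l > 0" using ge w_nth by force
    have "A ^\<^sub>m k *\<^sub>v w = A ^\<^sub>m k *\<^sub>v (A *\<^sub>v u) - A ^\<^sub>m k *\<^sub>v (r \<cdot>\<^sub>v u)"
      unfolding w_def using carrier u Au by (intro mult_minus_distrib_mat_vec) auto
    also have "A ^\<^sub>m k *\<^sub>v (A *\<^sub>v u) = A *\<^sub>v z"
      unfolding z_def using carrier u pow_mat_comm[OF carrier, of k]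
      by (simp flip: assoc_mult_mat_vec[where ?n\<^sub>1 = d and ?n\<^sub>2 = d and ?n\<^sub>3 = d])
    also have "A ^\<^sub>m k *\<^sub>v (r \<cdot>\<^sub>v u) = r \<cdot>\<^sub>v z"
      unfolding z_def using carrier u by (intro mult_mat_vec) auto
    finally have Aw: "A ^\<^sub>m k *\<^sub>v w = A *\<^sub>v z - r \<cdot>\<^sub>v z" .
    have gt: "(A *\<^sub>v z) $ i > r * z $ i" if i: "i < d" for i
    proof -
      have "0 < (A ^\<^sub>m k *\<^sub>v w) $ i"
        using w w_nth ge l i by (intro pow_mult_pos[where j = l]) auto
      then show ?thesis unfolding Aw using z carrier i by simp
    qed
    \<comment> \<open>The minimum of finitely many quotients, each above \<open>r\<close>: the
      Collatz-Wielandt bound for \<open>z\<close>.\<close>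
    define s where "s = Min ((\<lambda>i. (A *\<^sub>v z) $ i / z $ i) ` {..<d})"
    have "s > r"
      unfolding s_def using d_pos z_pos gt
      by (subst Min_gr_iff) (auto simp: less_divide_eq simp del: index_mult_mat_vec)
    moreover have "(A *\<^sub>v z) $ i \<ge> s * z $ i" if "i < d" for i
    proof -
      have "s \<le> (A *\<^sub>v z) $ i / z $ i"
        unfolding s_def using that by (intro Min_le) auto
      then show ?thesis using z_pos[OF that] by (simp add: le_divide_eq del: index_mult_mat_vec)
    qed
    ultimately show False using z z_pos by (intro no_growth[of s z]) auto
  qed
  \<comment> \<open>By invariance the positive vector \<open>z\<close> equals
    \<open>r ^ k u\<close>, so \<open>r ^ k\<close> and all components of \<open>u\<close> are
    positive; \<open>k > 0\<close> then excludes \<open>r = 0\<close>.\<close>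
  have "z = r ^ k \<cdot>\<^sub>v u"
    unfolding z_def by (rule pow_mat_mult_eigen[OF carrier u(1) inv])
  then have *: "r ^ k * u $ i > 0" if "i < d" for i
    using z_pos[OF that] u(1) that by simp
  then have "r ^ k > 0"
    using u(2)[OF d_pos] *[OF d_pos] by (simp add: zero_less_mult_iff)
  then show "r > 0"
    using k_pos r_nonneg by (cases "r = 0") (auto simp: power_0_left)
  show "u $ i > 0" if "i < d" for i
    using *[OF that] \<open>r ^ k > 0\<close> zero_less_mult_pos by blast
qed

text \<open>The triangle inequality in each row shows that \<open>u\<close> is subinvariant:
  \<open>r u = |c v| = |A v| \<le> A u\<close>.\<close>

lemma peripheral_eigenvector_abs:
  fixes v :: "complex vec"
  assumes v: "v \<in> carrier_vec d" "v \<noteq> 0\<^sub>v d" "cmat A *\<^sub>v v = c \<cdot>\<^sub>v v" and c: "cmod c = r"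
  defines "u \<equiv> Matrix.vec d (\<lambda>i. cmod (v $ i))"
  shows "A *\<^sub>v u = r \<cdot>\<^sub>v u" "\<And>i. i < d \<Longrightarrow> u $ i > 0" "r > 0"
proof -
  have u: "u \<in> carrier_vec d" by (simp add: u_def)
  have u_nonneg: "u $ i \<ge> 0" if "i < d" for i
    using that by (simp add: u_def)
  have u_nz: "u \<noteq> 0\<^sub>v d"
  proof
    assume "u = 0\<^sub>v d"
    then have "v $ i = 0" if "i < d" for i
      using that by (metis index_vec index_zero_vec(1) norm_eq_zero u_def)
    then have "v = 0\<^sub>v d" using v(1) by (intro eq_vecI) auto
    then show False using v(2) by simp
  qed
  have ge: "(A *\<^sub>v u) $ i \<ge> r * u $ i" if i: "i < d" for i
  proof -
    have "r * u $ i = cmod ((c \<cdot>\<^sub>v v) $ i)"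
      using v(1) i by (simp add: u_def norm_mult c)
    also have "(c \<cdot>\<^sub>v v) $ i = (\<Sum>j<d. cmat A $$ (i, j) * v $ j)"
      unfolding v(3)[symmetric] using carrier v i by (intro mult_mat_vec_nth) auto
    also have "cmod \<dots> \<le> (\<Sum>j<d. cmod (cmat A $$ (i, j) * v $ j))"
      by (rule norm_sum)
    also have "\<dots> = (\<Sum>j<d. A $$ (i, j) * u $ j)"
      using i carrier nonneg by (intro sum.cong) (auto simp: u_def norm_mult)
    also have "\<dots> = (A *\<^sub>v u) $ i"
      using carrier u i by (intro mult_mat_vec_nth[symmetric]) auto
    finally show ?thesis .
  qed
  note inv = subinvariant_imp_invariant[OF u u_nonneg u_nz ge]
  show "A *\<^sub>v u = r \<cdot>\<^sub>v u" "\<And>i. i < d \<Longrightarrow> u $ i > 0" "r > 0"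
    using inv by blast+
qed

lemma perron_vector:
  obtains u :: "real vec" where "u \<in> carrier_vec d" "\<And>i. i < d \<Longrightarrow> u $ i > 0" "A *\<^sub>v u = r \<cdot>\<^sub>v u"
proof -
  obtain c where c: "eigenvalue (cmat A) c" "cmod c = r" by (rule max_eigenvalue)
  from c(1) obtain v where v: "v \<in> carrier_vec d" "v \<noteq> 0\<^sub>v d" "cmat A *\<^sub>v v = c \<cdot>\<^sub>v v"
    using eigenvalueE cmat_carrier by blast
  note abs = peripheral_eigenvector_abs[OF v c(2)]
  show ?thesis by (rule that[OF _ abs(2) abs(1)]) auto
qed

lemma r_pos: "r > 0"
proof -
  obtain c where c: "eigenvalue (cmat A) c" "cmod c = r" by (rule max_eigenvalue)
  from c(1) obtain v where v: "v \<in> carrier_vec d" "v \<noteq> 0\<^sub>v d" "cmat A *\<^sub>v v = c \<cdot>\<^sub>v v"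
    using eigenvalueE cmat_carrier by blast
  show ?thesis by (rule peripheral_eigenvector_abs(3)[OF v c(2)])
qed

lemma transpose_primitive: "primitive_matrix (transpose_mat A) d k"
proof
  show "(transpose_mat A ^\<^sub>m k) $$ (i, j) > 0" if "i < d" "j < d" for i j
    using that carrier pow_pos[of j i] by (simp add: transpose_pow_mat[OF carrier])
qed (use carrier d_pos k_pos nonneg in auto)

text \<open>Transposition preserves the characteristic polynomial. Thus the left Perron vector
  belongs to the same \<open>r\<close>.\<close>

lemma spectral_radius_transpose: "spectral_radius (cmat (transpose_mat A)) = r"
proof -
  have "cmat (transpose_mat A) = transpose_mat (cmat A)"
    by (intro eq_matI) auto
  then have "spectrum (cmat (transpose_mat A)) = spectrum (cmat A)"
    using spectrum_root_char_poly[OF cmat_carrier]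
      spectrum_root_char_poly[of "transpose_mat (cmat A)" d] char_poly_transpose_mat[OF cmat_carrier]
      carrier by simp
  then show ?thesis by (simp add: spectral_radius_def)
qed

lemma left_perron_vector:
  obtains y :: "real vec" where "y \<in> carrier_vec d" "\<And>i. i < d \<Longrightarrow> y $ i > 0" "transpose_mat A *\<^sub>v y = r \<cdot>\<^sub>v y"
  using primitive_matrix.perron_vector[OF transpose_primitive]
  unfolding spectral_radius_transpose by blast

end

section \<open>Left and right Perron vectors and spectral dominance\<close>

lemma outer_mat_carrier:
  assumes "x \<in> carrier_vec n" "y \<in> carrier_vec m"
  shows "outer_mat x y \<in> carrier_mat n m"
  using assms by (auto simp: outer_mat_def carrier_matI)

lemma outer_mat_nth:
  fixes x y :: "real vec"
  assumes "x \<in> carrier_vec n" "y \<in> carrier_vec m" "i < n" "j < m"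
  shows "outer_mat x y $$ (i, j) = x $ i * y $ j"
  using assms by (simp add: outer_mat_def scalar_prod_def)

text \<open>The normalization \<open>yx\<close> is what makes \<open>x y^T\<close> a projection; the
  condition on the sum of \<open>x\<close> is imposed when the pair is constructed.\<close>

locale perron_pair = primitive_matrix +
  fixes x y :: "real vec"
  assumes x: "x \<in> carrier_vec d" and x_pos: "\<And>i. i < d \<Longrightarrow> x $ i > 0"
    and x_eigen: "A *\<^sub>v x = r \<cdot>\<^sub>v x"
    and y: "y \<in> carrier_vec d" and y_pos: "\<And>i. i < d \<Longrightarrow> y $ i > 0"
    and y_eigen: "transpose_mat A *\<^sub>v y = r \<cdot>\<^sub>v y"
    and yx: "(\<Sum>i<d. y $ i * x $ i) = 1"
begin

lemma A_x_sum: "i < d \<Longrightarrow> (\<Sum>j<d. A $$ (i, j) * x $ j) = r * x $ i"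
  using mult_mat_vec_nth[OF carrier x, of i] x_eigen x by simp

lemma y_A_sum:
  assumes "j < d"
  shows "(\<Sum>i<d. y $ i * A $$ (i, j)) = r * y $ j"
proof -
  have "r * y $ j = (transpose_mat A *\<^sub>v y) $ j"
    unfolding y_eigen using assms y by simp
  also have "\<dots> = (\<Sum>i<d. transpose_mat A $$ (j, i) * y $ i)"
    using carrier y assms by (intro mult_mat_vec_nth) auto
  also have "\<dots> = (\<Sum>i<d. y $ i * A $$ (i, j))"
    using carrier assms by (intro sum.cong) auto
  finally show ?thesis by simp
qed

lemma left_eigen: "mat_of_row y * A = r \<cdot>\<^sub>m mat_of_row y"
proof (rule eq_matI)
  fix i j assume "i < dim_row (r \<cdot>\<^sub>m mat_of_row y)" "j < dim_col (r \<cdot>\<^sub>m mat_of_row y)"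
  then have i: "i = 0" and j: "j < d" using y by auto
  have "(mat_of_row y * A) $$ (0, j) = (\<Sum>k<d. mat_of_row y $$ (0, k) * A $$ (k, j))"
    using y carrier j by (intro mult_mat_nth) auto
  also have "\<dots> = r * y $ j"
    using y y_A_sum[OF j] by simp
  finally show "(mat_of_row y * A) $$ (i, j) = (r \<cdot>\<^sub>m mat_of_row y) $$ (i, j)"
    using i j y by simp
qed (use y carrier in auto)

lemma eigenvalue_r: "eigenvalue (cmat A) (complex_of_real r)"
proof (rule eigenvalueI[OF cmat_carrier])
  show "map_vec complex_of_real x \<in> carrier_vec d" using x by simp
  show "cmat A *\<^sub>v map_vec complex_of_real x = complex_of_real r \<cdot>\<^sub>v map_vec complex_of_real x"
    unfolding of_real_hom.mult_mat_vec_hom[OF carrier x, symmetric] x_eigen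
    by (rule of_real_hom.vec_hom_smult)
  show "map_vec complex_of_real x \<noteq> 0\<^sub>v d"
  proof
    assume "map_vec complex_of_real x = 0\<^sub>v d"
    then have "map_vec complex_of_real x $ 0 = 0\<^sub>v d $ 0" by (rule arg_cong)
    then show False using x x_pos[OF d_pos] d_pos by simp
  qed
qed

text \<open>For \<open>|c| = r\<close>, equality in the triangle inequality gives
  \<open>v = b |v|\<close> with a scalar \<open>b\<close>. Then \<open>0 = y^T v = b y^T |v|\<close>
  with \<open>y^T |v| > 0\<close>, so \<open>b = 0\<close> and \<open>v = 0\<close>.\<close>

lemma orthogonal_eigenvalue_less:
  fixes v :: "complex vec"
  assumes v: "v \<in> carrier_vec d" "v \<noteq> 0\<^sub>v d" "cmat A *\<^sub>v v = c \<cdot>\<^sub>v v"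
    and orth: "(\<Sum>j<d. complex_of_real (y $ j) * v $ j) = 0"
  shows "cmod c < r"
proof (rule ccontr)
  assume "\<not> cmod c < r"
  moreover have "cmod c \<le> r"
    using eigenvalueI[OF cmat_carrier v] by (rule eigenvalue_cmod_le)
  ultimately have c: "cmod c = r" by simp
  define u where "u = Matrix.vec d (\<lambda>i. cmod (v $ i))"
  have u: "u \<in> carrier_vec d" by (simp add: u_def)
  have Au: "A *\<^sub>v u = r \<cdot>\<^sub>v u" and u_pos: "\<And>i. i < d \<Longrightarrow> u $ i > 0"
    using peripheral_eigenvector_abs[OF v c] by (simp_all add: u_def)
  \<comment> \<open>Row 0 of \<open>A ^ k\<close> supplies the positive weights. Comparing
    \<open>A ^ k v = c ^ k v\<close> with \<open>A ^ k u = r ^ k u\<close> yields equality of the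
    moduli.\<close>
  have "(\<Sum>j<d. complex_of_real ((A ^\<^sub>m k) $$ (0, j)) * v $ j) = (cmat A ^\<^sub>m k *\<^sub>v v) $ 0"
    using carrier v d_pos mult_mat_vec_nth[of "cmat A ^\<^sub>m k" d d v 0]
    by (simp add: cmat_pow_nth del: index_mult_mat_vec)
  also have "\<dots> = c ^ k * v $ 0"
    unfolding pow_mat_mult_eigen[OF cmat_carrier v(1) v(3)] using v(1) d_pos by simp
  finally have "cmod (\<Sum>j<d. complex_of_real ((A ^\<^sub>m k) $$ (0, j)) * v $ j) = r ^ k * u $ 0"
    using d_pos by (simp add: norm_mult norm_power c u_def)
  also have "\<dots> = (A ^\<^sub>m k *\<^sub>v u) $ 0"
    unfolding pow_mat_mult_eigen[OF carrier u Au] using u d_pos by simp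
  also have "\<dots> = (\<Sum>j<d. (A ^\<^sub>m k) $$ (0, j) * u $ j)"
    using carrier u d_pos by (intro mult_mat_vec_nth) auto
  also have "\<dots> = (\<Sum>j<d. (A ^\<^sub>m k) $$ (0, j) * cmod (v $ j))"
    by (simp add: u_def)
  finally obtain b where b: "\<And>j. j < d \<Longrightarrow> v $ j = b * complex_of_real (cmod (v $ j))"
    using weighted_triangle_equality[of "{..<d}" "\<lambda>j. (A ^\<^sub>m k) $$ (0, j)" "\<lambda>j. v $ j"]
      pow_pos[OF d_pos] by auto
  have "(\<Sum>j<d. complex_of_real (y $ j) * v $ j) =
      (\<Sum>j<d. b * complex_of_real (y $ j * u $ j))"
  proof (rule sum.cong[OF refl])
    fix j assume j: "j \<in> {..<d}"
    then have "v $ j = b * complex_of_real (u $ j)" using b[of j] by (simp add: u_def)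
    then show "complex_of_real (y $ j) * v $ j = b * complex_of_real (y $ j * u $ j)"
      by (simp only: of_real_mult mult_ac)
  qed
  also have "\<dots> = b * complex_of_real (\<Sum>j<d. y $ j * u $ j)"
    by (simp add: sum_distrib_left)
  finally have "b * complex_of_real (\<Sum>j<d. y $ j * u $ j) = 0"
    using orth by simp
  moreover have "(\<Sum>j<d. y $ j * u $ j) > 0"
    using u_pos y_pos d_pos by (intro sum_pos) auto
  ultimately have "b = 0" by (metis mult_eq_0_iff of_real_eq_0_iff less_irrefl)
  then have "v $ j = 0" if "j < d" for j
    using b[OF that] by simp
  then have "v = 0\<^sub>v d" using v(1) by (intro eq_vecI) auto
  then show False using v(2) by simp
qed

lemma y_eigen_sum:
  fixes v :: "complex vec"
  assumes v: "v \<in> carrier_vec d"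
  shows "(\<Sum>i<d. complex_of_real (y $ i) * (cmat A *\<^sub>v v) $ i) =
    complex_of_real r * (\<Sum>j<d. complex_of_real (y $ j) * v $ j)"
proof -
  have "(\<Sum>i<d. complex_of_real (y $ i) * (cmat A *\<^sub>v v) $ i) =
      (\<Sum>i<d. \<Sum>j<d. complex_of_real (y $ i * A $$ (i, j)) * v $ j)"
  proof (rule sum.cong[OF refl])
    fix i assume "i \<in> {..<d}"
    then have "(cmat A *\<^sub>v v) $ i = (\<Sum>j<d. complex_of_real (A $$ (i, j)) * v $ j)"
      using mult_mat_vec_nth[OF cmat_carrier v, of i] carrier by simp
    then show "complex_of_real (y $ i) * (cmat A *\<^sub>v v) $ i =
        (\<Sum>j<d. complex_of_real (y $ i * A $$ (i, j)) * v $ j)"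
      by (simp only: sum_distrib_left of_real_mult mult.assoc)
  qed
  also have "\<dots> = (\<Sum>j<d. \<Sum>i<d. complex_of_real (y $ i * A $$ (i, j)) * v $ j)"
    by (rule sum.swap)
  also have "\<dots> = (\<Sum>j<d. complex_of_real (r * y $ j) * v $ j)"
    by (intro sum.cong refl)
      (simp only: sum_distrib_right[symmetric] of_real_sum[symmetric] y_A_sum lessThan_iff)
  also have "\<dots> = complex_of_real r * (\<Sum>j<d. complex_of_real (y $ j) * v $ j)"
    by (simp add: sum_distrib_left mult.assoc)
  finally show ?thesis .
qed

text \<open>Applying \<open>y^T\<close> to \<open>A v = c v\<close> gives
  \<open>c y^T v = r y^T v\<close>, so \<open>c \<noteq> r\<close> forces \<open>v\<close> to be
  orthogonal to \<open>y\<close>.\<close>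

lemma eigenvalue_less:
  assumes "eigenvalue (cmat A) c" "c \<noteq> complex_of_real r"
  shows "cmod c < r"
proof -
  obtain v where v: "v \<in> carrier_vec d" "v \<noteq> 0\<^sub>v d" "cmat A *\<^sub>v v = c \<cdot>\<^sub>v v"
    using eigenvalueE[OF assms(1) cmat_carrier] by blast
  have "c * (\<Sum>j<d. complex_of_real (y $ j) * v $ j) =
      complex_of_real r * (\<Sum>j<d. complex_of_real (y $ j) * v $ j)"
    using y_eigen_sum[OF v(1)] v(1) unfolding v(3) by (simp add: sum_distrib_left mult_ac)
  then show ?thesis
    using assms(2) by (intro orthogonal_eigenvalue_less[OF v]) auto
qed

section \<open>Deflation and convergence of the normalized powers\<close>

abbreviation "E \<equiv> (1 / r) \<cdot>\<^sub>m A"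
abbreviation "L \<equiv> outer_mat x y"

lemma E_carrier: "E \<in> carrier_mat d d" and L_carrier: "L \<in> carrier_mat d d"
  using carrier outer_mat_carrier[OF x y] by auto

lemma L_nth: "i < d \<Longrightarrow> j < d \<Longrightarrow> L $$ (i, j) = x $ i * y $ j"
  by (rule outer_mat_nth[OF x y])

lemma E_nth: "i < d \<Longrightarrow> j < d \<Longrightarrow> E $$ (i, j) = A $$ (i, j) / r"
  using carrier by simp

lemma E_mult_L: "E * L = L"
proof (rule eq_matI)
  fix i j assume "i < dim_row L" "j < dim_col L"
  then have ij: "i < d" "j < d" using L_carrier by auto
  have "(E * L) $$ (i, j) = (\<Sum>k<d. E $$ (i, k) * L $$ (k, j))"
    by (rule mult_mat_nth[OF E_carrier L_carrier ij])
  also have "\<dots> = (\<Sum>k<d. A $$ (i, k) * x $ k) * (y $ j / r)"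
    using ij by (simp add: sum_distrib_right sum_divide_distrib E_nth L_nth mult.assoc del: index_smult_mat)
  also have "\<dots> = L $$ (i, j)"
    using ij r_pos by (simp add: A_x_sum L_nth)
  finally show "(E * L) $$ (i, j) = L $$ (i, j)" .
qed (use E_carrier L_carrier in auto)

lemma L_mult_E: "L * E = L"
proof (rule eq_matI)
  fix i j assume "i < dim_row L" "j < dim_col L"
  then have ij: "i < d" "j < d" using L_carrier by auto
  have "(L * E) $$ (i, j) = (\<Sum>k<d. L $$ (i, k) * E $$ (k, j))"
    by (rule mult_mat_nth[OF L_carrier E_carrier ij])
  also have "\<dots> = (x $ i / r) * (\<Sum>k<d. y $ k * A $$ (k, j))"
    using ij by (simp add: sum_distrib_left E_nth L_nth mult.assoc del: index_smult_mat)
  also have "\<dots> = L $$ (i, j)"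
    using ij r_pos by (simp add: y_A_sum L_nth)
  finally show "(L * E) $$ (i, j) = L $$ (i, j)" .
qed (use E_carrier L_carrier in auto)

lemma L_mult_L: "L * L = L"
proof (rule eq_matI)
  fix i j assume "i < dim_row L" "j < dim_col L"
  then have ij: "i < d" "j < d" using L_carrier by auto
  have "(L * L) $$ (i, j) = (\<Sum>k<d. L $$ (i, k) * L $$ (k, j))"
    by (rule mult_mat_nth[OF L_carrier L_carrier ij])
  also have "\<dots> = x $ i * (\<Sum>k<d. y $ k * x $ k) * y $ j"
    using ij by (simp add: sum_distrib_left sum_distrib_right L_nth mult.assoc)
  also have "\<dots> = L $$ (i, j)"
    using ij by (simp add: yx L_nth)
  finally show "(L * L) $$ (i, j) = L $$ (i, j)" .
qed (use L_carrier in auto)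

lemma pow_E_mult_L: "E ^\<^sub>m m * L = L"
proof (induction m)
  case 0
  then show ?case using carrier left_mult_one_mat[OF L_carrier] by simp
next
  case (Suc m)
  have "E ^\<^sub>m Suc m * L = E ^\<^sub>m m * (E * L)"
    using E_carrier L_carrier by (simp add: assoc_mult_mat[of "E ^\<^sub>m m" d d E d L d])
  then show ?case by (simp add: E_mult_L Suc)
qed

text \<open>The relations \<open>E L = L E = L L = L\<close> collapse the mixed terms. Exponents
  start at 1, since the power 0 is the identity on both sides.\<close>

lemma pow_E_minus_L: "(E - L) ^\<^sub>m Suc m = E ^\<^sub>m Suc m - L"
proof (induction m)
  case 0
  then show ?case
    using left_mult_one_mat[OF minus_carrier_mat[OF L_carrier, of E]] left_mult_one_mat[OF E_carrier]
      L_carrier E_carrier carrier by simp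
next
  case (Suc m)
  let ?F = "E ^\<^sub>m Suc m"
  have F: "?F \<in> carrier_mat d d" using E_carrier by (rule pow_carrier_mat)
  have "(E - L) ^\<^sub>m Suc (Suc m) = (?F - L) * (E - L)"
    by (simp only: pow_mat.simps(2)[of "E - L" "Suc m"] Suc)
  also have "\<dots> = ?F * (E - L) - L * (E - L)"
    using F E_carrier L_carrier by (intro minus_mult_distrib_mat) auto
  also have "?F * (E - L) = ?F * E - ?F * L"
    using F E_carrier L_carrier by (intro mult_minus_distrib_mat) auto
  also have "L * (E - L) = L * E - L * L"
    using E_carrier L_carrier by (intro mult_minus_distrib_mat) auto
  also have "?F * E - ?F * L - (L * E - L * L) = E ^\<^sub>m Suc (Suc m) - L"
    unfolding pow_E_mult_L L_mult_E L_mult_L pow_mat.simps(2)[of E "Suc m", symmetric]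
    using E_carrier L_carrier by (intro eq_matI) auto
  finally show ?case .
qed

text \<open>Since \<open>y^T (E - L) = 0\<close>, an eigenvector \<open>v\<close> for
  \<open>c \<noteq> 0\<close> is orthogonal to \<open>y\<close>. Hence \<open>L v = 0\<close> and
  \<open>A v = r c v\<close>, and orthogonality gives \<open>|r c| < r\<close>.\<close>

lemma deflated_eigenvalue_less:
  assumes "eigenvalue (cmat (E - L)) c"
  shows "cmod c < 1"
proof (cases "c = 0")
  case False
  have N: "cmat (E - L) \<in> carrier_mat d d"
    unfolding map_carrier_mat by (rule minus_carrier_mat[OF L_carrier])
  obtain v where v: "v \<in> carrier_vec d" "v \<noteq> 0\<^sub>v d" "cmat (E - L) *\<^sub>v v = c \<cdot>\<^sub>v v"
    using eigenvalueE[OF assms N] by blast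
  define s where "s = (\<Sum>j<d. complex_of_real (y $ j) * v $ j)"
  have cv: "c * v $ i = (cmat A *\<^sub>v v) $ i / complex_of_real r - complex_of_real (x $ i) * s"
    if i: "i < d" for i
  proof -
    have "c * v $ i = (cmat (E - L) *\<^sub>v v) $ i"
      unfolding v(3) using v(1) i by simp
    also have "\<dots> = (\<Sum>j<d. cmat (E - L) $$ (i, j) * v $ j)"
      by (rule mult_mat_vec_nth[OF N v(1) i])
    also have "\<dots> = (\<Sum>j<d. cmat A $$ (i, j) * v $ j / complex_of_real r -
        complex_of_real (x $ i) * (complex_of_real (y $ j) * v $ j))"
      using i carrier L_carrier by (intro sum.cong) (simp_all add: L_nth algebra_simps)
    also have "\<dots> = (cmat A *\<^sub>v v) $ i / complex_of_real r - complex_of_real (x $ i) * s"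
      unfolding mult_mat_vec_nth[OF cmat_carrier v(1) i] s_def
      by (simp add: sum_subtractf sum_divide_distrib sum_distrib_left)
    finally show ?thesis .
  qed
  have "c * s = (\<Sum>i<d. complex_of_real (y $ i) * (c * v $ i))"
    by (simp add: s_def sum_distrib_left mult_ac)
  also have "\<dots> = (\<Sum>i<d. complex_of_real (y $ i) * (cmat A *\<^sub>v v) $ i / complex_of_real r -
      complex_of_real (y $ i * x $ i) * s)"
    by (intro sum.cong refl) (simp add: cv algebra_simps del: index_mult_mat_vec)
  also have "\<dots> = (\<Sum>i<d. complex_of_real (y $ i) * (cmat A *\<^sub>v v) $ i) / complex_of_real r -
      complex_of_real (\<Sum>i<d. y $ i * x $ i) * s"
    by (simp only: sum_subtractf sum_divide_distrib sum_distrib_right of_real_sum)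
  also have "\<dots> = 0"
    unfolding y_eigen_sum[OF v(1)] yx using r_pos by (simp add: s_def)
  finally have s: "s = 0" using False by simp
  have "cmat A *\<^sub>v v = (complex_of_real r * c) \<cdot>\<^sub>v v"
  proof (rule eq_vecI)
    fix i assume "i < dim_vec ((complex_of_real r * c) \<cdot>\<^sub>v v)"
    then have i: "i < d" using v(1) by simp
    then show "(cmat A *\<^sub>v v) $ i = ((complex_of_real r * c) \<cdot>\<^sub>v v) $ i"
      using cv[OF i] s r_pos v(1) by (simp add: field_simps del: index_mult_mat_vec)
  qed (use v(1) carrier in auto)
  from orthogonal_eigenvalue_less[OF v(1,2) this] s
  have "r * cmod c < r * 1"
    using r_pos by (simp add: s_def norm_mult)
  then show ?thesis using r_pos by (simp only: mult_less_cancel_left_pos)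
qed simp

lemma pow_E_tendsto: "mat_tendsto d (\<lambda>m. E ^\<^sub>m m) L"
  unfolding mat_tendsto_def
proof (intro conjI allI impI)
  show "E ^\<^sub>m m \<in> carrier_mat d d" for m using E_carrier by (rule pow_carrier_mat)
  show "L \<in> carrier_mat d d" by (rule L_carrier)
next
  fix i j assume i: "i < d" and j: "j < d"
  have N: "E - L \<in> carrier_mat d d" by (rule minus_carrier_mat[OF L_carrier])
  have "(\<lambda>m. (cmat (E - L) ^\<^sub>m m) $$ (i, j)) \<longlonglongrightarrow> 0"
    using N i j deflated_eigenvalue_less by (intro pow_mat_tendsto_0[of _ d]) auto
  moreover have "(cmat (E - L) ^\<^sub>m m) $$ (i, j) = complex_of_real (((E - L) ^\<^sub>m m) $$ (i, j))" for m
    using N i j by (rule cmat_pow_nth)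
  ultimately have "(\<lambda>m. ((E - L) ^\<^sub>m m) $$ (i, j)) \<longlonglongrightarrow> 0"
    by (simp add: tendsto_of_real_iff[where c = 0 and 'a = complex, simplified])
  \<comment> \<open>Shifting the sequence by one is harmless for the limit and allows
    \<open>pow_E_minus_L\<close> to be applied.\<close>
  then have "(\<lambda>m. ((E - L) ^\<^sub>m Suc m) $$ (i, j) + L $$ (i, j)) \<longlonglongrightarrow> 0 + L $$ (i, j)"
    by (intro tendsto_add tendsto_const LIMSEQ_Suc)
  moreover have "((E - L) ^\<^sub>m Suc m) $$ (i, j) + L $$ (i, j) = (E ^\<^sub>m Suc m) $$ (i, j)" for m
    unfolding pow_E_minus_L using i j L_carrier pow_carrier_mat[OF E_carrier, of "Suc m"]
    by (simp del: pow_mat.simps)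
  ultimately have "(\<lambda>m. (E ^\<^sub>m Suc m) $$ (i, j)) \<longlonglongrightarrow> L $$ (i, j)" by simp
  then show "(\<lambda>m. (E ^\<^sub>m m) $$ (i, j)) \<longlonglongrightarrow> L $$ (i, j)"
    by (rule LIMSEQ_imp_Suc)
qed

text \<open>The trace of \<open>E ^ m\<close> tends to \<open>y \<bullet> x = 1\<close>, and by dominance to the multiplicity of \<open>r\<close>.\<close>

lemma order_r: "order (complex_of_real r) (char_poly (cmat A)) = 1"
proof -
  obtain es where es: "char_poly (cmat A) = (\<Prod>a\<leftarrow>es. [:- a, 1:])"
    using char_poly_factorized[OF cmat_carrier] by blast
  let ?count = "length (filter ((=) (complex_of_real r)) es)"
  have E_trace: "(\<Sum>a\<leftarrow>es. (a / complex_of_real r) ^ m) =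
      complex_of_real (\<Sum>i<d. (E ^\<^sub>m m) $$ (i, i))" for m
  proof -
    have "(\<Sum>a\<leftarrow>es. (a / complex_of_real r) ^ m) = (\<Sum>a\<leftarrow>es. a ^ m) / complex_of_real r ^ m"
      by (induction es) (simp_all add: add_divide_distrib power_divide)
    also have "(\<Sum>a\<leftarrow>es. a ^ m) = (\<Sum>i<d. (cmat A ^\<^sub>m m) $$ (i, i))"
      by (rule trace_pow_mat[OF cmat_carrier es, symmetric])
    also have "\<dots> / complex_of_real r ^ m = complex_of_real (\<Sum>i<d. (E ^\<^sub>m m) $$ (i, i))"
      using carrier
      by (simp add: smult_pow_mat[OF carrier] cmat_pow_nth[OF carrier] sum_divide_distrib power_divide)
    finally show ?thesis .
  qed
  have "(\<lambda>m. \<Sum>i<d. (E ^\<^sub>m m) $$ (i, i)) \<longlonglongrightarrow> (\<Sum>i<d. L $$ (i, i))"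
    using pow_E_tendsto by (intro tendsto_sum) (auto simp: mat_tendsto_def)
  also have "(\<Sum>i<d. L $$ (i, i)) = 1"
    using yx by (simp add: L_nth mult.commute)
  finally have lim1: "(\<lambda>m. \<Sum>a\<leftarrow>es. (a / complex_of_real r) ^ m) \<longlonglongrightarrow> complex_of_real 1"
    unfolding E_trace by (rule tendsto_of_real)
  have es_le: "a = complex_of_real r \<or> cmod a < r" if "a \<in> set es" for a
  proof -
    have "poly (char_poly (cmat A)) a = 0"
      unfolding es using that by (rule linear_poly_root)
    then show ?thesis
      using eigenvalue_root_char_poly[OF cmat_carrier, of a] eigenvalue_less by blast
  qed
  \<comment> \<open>The claim is stated for lists \<open>es'\<close> with entries from
    \<open>es\<close>, so that \<open>es_le\<close> stays available in the induction. Entries equal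
    to \<open>r\<close> contribute 1 for every \<open>m\<close>, all others tend to zero.\<close>
  have "(\<lambda>m. \<Sum>a\<leftarrow>es'. (a / complex_of_real r) ^ m) \<longlonglongrightarrow>
      of_nat (length (filter ((=) (complex_of_real r)) es'))" if "set es' \<subseteq> set es" for es'
    using that
  proof (induction es')
    case (Cons a es')
    have "(\<lambda>m. (a / complex_of_real r) ^ m) \<longlonglongrightarrow> (if a = complex_of_real r then 1 else 0)"
    proof (cases "a = complex_of_real r")
      case True
      then show ?thesis using r_pos by simp
    next
      case False
      then have "cmod (a / complex_of_real r) < 1"
        using es_le[of a] Cons.prems r_pos by (auto simp: norm_divide)
      then show ?thesis using False by (simp add: LIMSEQ_power_zero)
    qed
    from tendsto_add[OF this Cons.IH] Cons.prems show ?case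
      by (auto split: if_splits)
  qed simp
  from this[of es] lim1 have "of_nat ?count = (1 :: complex)"
    using LIMSEQ_unique by fastforce
  then have "?count = 1" by (simp only: of_nat_eq_1_iff)
  then show ?thesis by (simp add: es order_prod_linear)
qed

end

text \<open>Scaling the right vector by \<open>1 / a\<close> makes its components sum to 1; the
  factor \<open>a / b\<close> on the left vector then restores \<open>y^T x = 1\<close>.\<close>

lemma (in primitive_matrix) perron_pair_exists:
  obtains x y where "perron_pair A d k x y" "(\<Sum>i<d. x $ i) = 1"
proof -
  obtain u where u: "u \<in> carrier_vec d" "\<And>i. i < d \<Longrightarrow> u $ i > 0" "A *\<^sub>v u = r \<cdot>\<^sub>v u"
    using perron_vector by blast
  obtain w where w: "w \<in> carrier_vec d" "\<And>i. i < d \<Longrightarrow> w $ i > 0"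
    "transpose_mat A *\<^sub>v w = r \<cdot>\<^sub>v w"
    using left_perron_vector by blast
  define a where "a = (\<Sum>i<d. u $ i)"
  define b where "b = (\<Sum>i<d. w $ i * u $ i)"
  have a: "a > 0" unfolding a_def using u d_pos by (intro sum_pos) auto
  have b: "b > 0" unfolding b_def using u w d_pos by (intro sum_pos) auto
  have "perron_pair A d k ((1 / a) \<cdot>\<^sub>v u) ((a / b) \<cdot>\<^sub>v w)"
  proof
    show "A *\<^sub>v ((1 / a) \<cdot>\<^sub>v u) = r \<cdot>\<^sub>v ((1 / a) \<cdot>\<^sub>v u)"
      unfolding mult_mat_vec[OF carrier u(1)] u(3) by (simp add: smult_smult_assoc mult.commute)
    show "transpose_mat A *\<^sub>v ((a / b) \<cdot>\<^sub>v w) = r \<cdot>\<^sub>v ((a / b) \<cdot>\<^sub>v w)"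
      using carrier by (simp add: mult_mat_vec[OF _ w(1)] w(3) smult_smult_assoc mult.commute)
    have "(\<Sum>i<d. ((a / b) \<cdot>\<^sub>v w) $ i * ((1 / a) \<cdot>\<^sub>v u) $ i) = (\<Sum>i<d. w $ i * u $ i / b)"
      using u(1) w(1) a by (intro sum.cong) auto
    also have "\<dots> = 1" using b by (simp add: b_def flip: sum_divide_distrib)
    finally show "(\<Sum>i<d. ((a / b) \<cdot>\<^sub>v w) $ i * ((1 / a) \<cdot>\<^sub>v u) $ i) = 1" .
  qed (use u w a b in auto)
  moreover have "(\<Sum>i<d. ((1 / a) \<cdot>\<^sub>v u) $ i) = (\<Sum>i<d. u $ i / a)"
    using u(1) by (intro sum.cong) auto
  then have "(\<Sum>i<d. ((1 / a) \<cdot>\<^sub>v u) $ i) = 1"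
    using a by (simp add: a_def flip: sum_divide_distrib)
  ultimately show ?thesis by (rule that)
qed

section \<open>The Hessenberg matrix\<close>

lemma M_mat_carrier: "M_mat h n \<in> carrier_mat (n - 1) (n - 1)"
  by (simp add: M_mat_def)

lemma M_mat_nonneg:
  assumes "\<And>k. k \<ge> 1 \<Longrightarrow> h k > 0" "i < n - 1" "j < n - 1"
  shows "M_mat h n $$ (i, j) \<ge> 0"
  using assms(1)[of "j + 1"] assms(2,3) c_seq_pos[of "i + 1 - j"] by (simp add: M_mat_def less_imp_le)

lemma M_mat_pos:
  assumes "\<And>k. k \<ge> 1 \<Longrightarrow> h k > 0" "i < n - 1" "j < n - 1" "j \<le> i + 1"
  shows "M_mat h n $$ (i, j) > 0"
  using assms(1)[of "j + 1"] assms(2-) c_seq_pos[of "i + 1 - j"] by (simp add: M_mat_def)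

text \<open>Each further factor widens the band of entries known to be positive by one
  superdiagonal.\<close>

lemma M_mat_pow_pos:
  assumes h: "\<And>k. k \<ge> 1 \<Longrightarrow> h k > 0" and ij: "i < n - 1" "j < n - 1" "j \<le> i + m" and m: "m \<ge> 1"
  shows "(M_mat h n ^\<^sub>m m) $$ (i, j) > 0"
  using m ij
proof (induction m arbitrary: i j rule: dec_induct)
  case base
  then show ?case
    using M_mat_carrier[of h n] by (simp add: M_mat_pos[OF h])
next
  case (step m)
  let ?M = "M_mat h n"
  note carr = M_mat_carrier[of h n]
  \<comment> \<open>A path from \<open>i\<close> to \<open>j\<close> through \<open>l\<close>: the
    last step uses the superdiagonal entry \<open>(j - 1, j)\<close>, or the diagonal entry
    \<open>(0, 0)\<close> if \<open>j = 0\<close>.\<close>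
  define l where "l = (if j = 0 then 0 else j - 1)"
  have "0 < (\<Sum>k<n - 1. (?M ^\<^sub>m m) $$ (i, k) * ?M $$ (k, j))"
  proof (rule sum_pos2)
    show "l \<in> {..<n - 1}" using step.prems by (auto simp: l_def)
    show "0 < (?M ^\<^sub>m m) $$ (i, l) * ?M $$ (l, j)"
      using step.prems by (intro mult_pos_pos step.IH M_mat_pos[OF h]) (auto simp: l_def)
    show "0 \<le> (?M ^\<^sub>m m) $$ (i, k) * ?M $$ (k, j)" if "k \<in> {..<n - 1}" for k
      using that step.prems
      by (intro mult_nonneg_nonneg pow_mat_nonneg[OF carr] M_mat_nonneg[OF h]) auto
  qed simp
  also have "\<dots> = (?M ^\<^sub>m Suc m) $$ (i, j)"
    using carr step.prems by (simp add: mult_mat_nth[of "?M ^\<^sub>m m" "n - 1" "n - 1" ?M "n - 1"] del: index_mult_mat)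
  finally show ?case .
qed

theorem theorem2p4:
  fixes h :: "nat \<Rightarrow> real" and n :: nat
  assumes "\<And>k. k \<ge> 1 \<Longrightarrow> h k > 0"
    and "h 1 = 1"
    and "n \<ge> 2"
  shows "primitive_mat (M_mat h n) \<and>
    rho h n > 0 \<and>
    eigenvalue (cmat (M_mat h n)) (complex_of_real (rho h n)) \<and>
    order (complex_of_real (rho h n)) (char_poly (cmat (M_mat h n))) = 1 \<and>
    (\<forall>\<beta>. eigenvalue (cmat (M_mat h n)) \<beta> \<and> \<beta> \<noteq> complex_of_real (rho h n) \<longrightarrow>
       cmod \<beta> < rho h n) \<and>
    (\<exists>x \<in> carrier_vec (n - 1). \<exists>y \<in> carrier_vec (n - 1).
       (\<forall>k<n - 1. x $ k > 0) \<and> (\<forall>k<n - 1. y $ k > 0) \<and>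
       (\<Sum>k<n - 1. x $ k) = 1 \<and> y \<bullet> x = 1 \<and>
       M_mat h n *\<^sub>v x = rho h n \<cdot>\<^sub>v x \<and>
       mat_of_row y * M_mat h n = rho h n \<cdot>\<^sub>m mat_of_row y \<and>
       mat_tendsto (n - 1) (\<lambda>m. ((1 / rho h n) \<cdot>\<^sub>m M_mat h n) ^\<^sub>m m) (outer_mat x y))"
proof -
  let ?M = "M_mat h n" and ?d = "n - 1"
  note carr = M_mat_carrier[of h n]
  \<comment> \<open>At exponent \<open>n - 1\<close> the band covers the whole matrix, because
    \<open>j < n - 1 \<le> i + (n - 1)\<close>.\<close>
  have pow_pos: "(?M ^\<^sub>m ?d) $$ (i, j) > 0" if "i < ?d" "j < ?d" for i j
    using that assms(3) by (intro M_mat_pow_pos[OF assms(1)]) auto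
  interpret primitive_matrix ?M ?d ?d
    using carr assms(3) pow_pos M_mat_nonneg[of h, OF assms(1)] by unfold_locales auto
  have prim: "primitive_mat ?M"
    unfolding primitive_mat_def
    using carr assms(3) nonneg pow_pos by (auto intro!: exI[of _ ?d])
  obtain x y where "perron_pair ?M ?d ?d x y" and x_sum: "(\<Sum>i<?d. x $ i) = 1"
    by (rule perron_pair_exists)
  then interpret perron_pair ?M ?d ?d x y by simp
  have yx': "y \<bullet> x = 1"
    using yx x by (simp add: scalar_prod_def atLeast0LessThan)
  show ?thesis
    unfolding rho_def
    using prim r_pos eigenvalue_r order_r eigenvalue_less x y x_pos y_pos x_sum yx' x_eigen
      left_eigen pow_E_tendsto
    by blast
qed

end
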